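(* Let $X$ be a countably infinite alphabet and let $w,w'\in X^*$. The identity $w\bumpeq w'$ holds in the Kauffman monoid $\mathcal{K}_3$ if and only if $\mathrm{alph}(w)=\mathrm{alph}(w')$ and, for each proper subset $Y\subsetneq\mathrm{alph}(w)$, the words $u:=w_Y$ and $u':=w'_Y$ satisfy the following three conditions: (a) the first letter of $u$ is the same as the first letter of $u'$; (b) the last letter of $u$ is the same as the last letter of $u'$; (c) for each word of length $2$ over $X$, the number of its occurrences in $u$ is the same as the number of its occurrences in $u'$.
   Context: The Kauffman monoid $\mathcal{K}_3$ is the monoid given by the presentation $$\mathcal{K}_3=\langle c,h_1,h_2\mid h_1h_2h_1=h_1,\ h_2h_1h_2=h_2,\ h_1^2=ch_1=h_1c,\ h_2^2=ch_2=h_2c\rangle .$$ $X^*$ is the free monoid over $X$ (finite words, including the empty word). An identity is a formal expression $w\bumpeq w'$ with $w,w'\in X^*$; it holds in a monoid $\mathcal{M}$ if every monoid homomorphism $\varphi\colon X^*\to\mathcal{M}$ takes the same value on $w$ and $w'$. For $w\in X^*$, $\mathrm{alph}(w)$ is the set of all letters that occur in $w$. For $Y\subseteq X$, $w_Y$ is the word obtained from $w$ by removing all occurrences of letters in $Y$. The empty set counts as a (possible) proper subset $Y$. An occurrence of a nonempty word $v$ in a word $w$ is a factorization $w=u_1vu_2$ with $u_1,u_2\in X^*$ (different factorizations being different occurrences, so occurrences may overlap). *)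

theory Defs
  imports "HOL-Algebra.Group" "HOL-Library.Countable_Set"
begin

definition free_monoid :: "'a set \<Rightarrow> 'a list monoid" where
  "free_monoid X = \<lparr>carrier = lists X, mult = (@), one = []\<rparr>"

text \<open>The library's \<^const>\<open>hom\<close> only asks for multiplicativity, which for monoids
  does not imply that the unit is preserved.\<close>

definition monoid_hom :: "('a, 'm) monoid_scheme \<Rightarrow> ('b, 'n) monoid_scheme \<Rightarrow> ('a \<Rightarrow> 'b) set" where
  "monoid_hom G H = {\<phi> \<in> hom G H. \<phi> \<one>\<^bsub>G\<^esub> = \<one>\<^bsub>H\<^esub>}"

definition identity_holds ::
    "'a set \<Rightarrow> ('b, 'n) monoid_scheme \<Rightarrow> 'a list \<Rightarrow> 'a list \<Rightarrow> bool" where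
  "identity_holds X M w w' \<longleftrightarrow> (\<forall>\<phi> \<in> monoid_hom (free_monoid X) M. \<phi> w = \<phi> w')"

inductive_set gen_congruence :: "('g list \<times> 'g list) set \<Rightarrow> ('g list \<times> 'g list) set"
  for R :: "('g list \<times> 'g list) set" where
  rel: "(u, v) \<in> R \<Longrightarrow> (u, v) \<in> gen_congruence R"
| refl: "(u, u) \<in> gen_congruence R"
| sym: "(u, v) \<in> gen_congruence R \<Longrightarrow> (v, u) \<in> gen_congruence R"
| trans: "(u, v) \<in> gen_congruence R \<Longrightarrow> (v, w) \<in> gen_congruence R \<Longrightarrow> (u, w) \<in> gen_congruence R"
| append: "(u, u') \<in> gen_congruence R \<Longrightarrow> (v, v') \<in> gen_congruence R \<Longrightarrow>
    (u @ v, u' @ v') \<in> gen_congruence R"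

text \<open>All elements of the type \<open>'g\<close> serve as generators; the elements of the monoid are
  the congruence classes of words.\<close>

definition presented_monoid :: "('g list \<times> 'g list) set \<Rightarrow> 'g list set monoid" where
  "presented_monoid R =
    \<lparr>carrier = UNIV // gen_congruence R,
     mult = (\<lambda>A B. \<Union>a\<in>A. \<Union>b\<in>B. gen_congruence R `` {a @ b}),
     one = gen_congruence R `` {[]}\<rparr>"

lemma equiv_gen_congruence: "equiv UNIV (gen_congruence R)"
proof (rule equivI)
  show "refl (gen_congruence R)" by (simp add: refl_on_def gen_congruence.refl)
  show "sym (gen_congruence R)" by (rule symI) (rule gen_congruence.sym)
  show "trans (gen_congruence R)" by (rule transI) (rule gen_congruence.trans)
qed simp_all

lemma mult_presented_monoid:
  "mult (presented_monoid R) (gen_congruence R `` {u}) (gen_congruence R `` {v}) =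
    gen_congruence R `` {u @ v}"
proof -
  have "gen_congruence R `` {a @ b} = gen_congruence R `` {u @ v}"
    if "a \<in> gen_congruence R `` {u}" "b \<in> gen_congruence R `` {v}" for a b
    using that gen_congruence.append[of u a R v b] equiv_class_eq[OF equiv_gen_congruence]
    by (metis Image_singleton_iff)
  moreover have "u \<in> gen_congruence R `` {u}" "v \<in> gen_congruence R `` {v}"
    by (auto intro: gen_congruence.refl)
  ultimately show ?thesis
    unfolding presented_monoid_def monoid.simps by blast
qed

lemma monoid_presented_monoid: "monoid (presented_monoid R)"
proof -
  have carr: "carrier (presented_monoid R) = range (\<lambda>u. gen_congruence R `` {u})"
    by (auto simp: presented_monoid_def quotient_def)
  have one: "one (presented_monoid R) = gen_congruence R `` {[]}"
    by (simp add: presented_monoid_def)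
  show ?thesis
    by (rule monoidI) (auto simp: carr one mult_presented_monoid)
qed

datatype kauffman_gen = c | h1 | h2

definition kauffman3_rels :: "(kauffman_gen list \<times> kauffman_gen list) set" where
  "kauffman3_rels =
    {([h1, h2, h1], [h1]), ([h2, h1, h2], [h2]),
     ([h1, h1], [c, h1]), ([c, h1], [h1, c]),
     ([h2, h2], [c, h2]), ([c, h2], [h2, c])}"

definition kauffman3 :: "kauffman_gen list set monoid" where
  "kauffman3 = presented_monoid kauffman3_rels"

hide_const (open) c h1 h2

definition delete_letters :: "'a set \<Rightarrow> 'a list \<Rightarrow> 'a list" where
  "delete_letters Y w = filter (\<lambda>x. x \<notin> Y) w"

definition occurrences :: "'a list \<Rightarrow> 'a list \<Rightarrow> nat" where
  "occurrences v w = card {(u1, u2). w = u1 @ v @ u2}"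

end

theory Submission
  imports Defs "HOL-Library.Multiset"
begin

text \<open>
  Modulo the relations, every word over \<open>c, h1, h2\<close> is equal to \<open>c^n\<close> or to \<open>c^n h(i,j)\<close>, where
  \<open>h(i,i)\<close> is the generator with index \<open>i\<close>, and \<open>h(i,j)\<close> for \<open>i \<noteq> j\<close> is the product of the generators
  with indices \<open>i\<close> and \<open>j\<close>. These elements multiply as in a Rees matrix semigroup:
  \<open>h(i,j) h(k,l) = c^e h(i,l)\<close> with \<open>e = 1\<close> if \<open>j = k\<close> and \<open>e = 0\<close> otherwise. So the monoid is isomorphic
  to an explicit monoid of pairs, the diagrams below (\<open>gen_congruence_iff_word_value_eq\<close>), and an
  identity holds if and only if both sides have the same value under each assignment of diagrams to
  letters.

  Let an assignment send the letters in \<open>Y\<close> to powers of \<open>c\<close> and each other letter \<open>x\<close> to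
  \<open>c^(n x) h(l x, r x)\<close>. Its value at \<open>w\<close> (\<open>word_value_assignment\<close>) involves the word \<open>u\<close> that is left
  after deleting \<open>Y\<close> only through its first letter, its last letter, and the number of adjacent
  letters \<open>x y\<close> in \<open>u\<close> with \<open>r x = l y\<close>; apart from that it depends on the letter multiplicities in
  \<open>w\<close>. These are recovered from the case where \<open>Y\<close> omits a single letter \<open>x\<close>, for a nonempty power of \<open>x\<close> is
  determined by the number of occurrences of \<open>x x\<close> in it. Hence the combinatorial conditions are sufficient.

  Conversely, central values detect the multiplicities of letters, and suitable \<open>l\<close> and \<open>r\<close> detect
  the first and the last letter of \<open>u\<close>. To detect the occurrences of \<open>x y\<close>, let \<open>r\<close> single out \<open>x\<close> and
  let \<open>l\<close> single out \<open>y\<close>: adjacent letters \<open>a b\<close> then contribute a factor \<open>c\<close> if and only if \<open>a = x\<close> and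
  \<open>b = y\<close> are both true or both false, and inclusion-exclusion (\<open>count_adjacent_pairs\<close>) expresses
  the wanted number through the exponent of \<open>c\<close> and data already known to agree.
\<close>

section \<open>Adjacent pairs of letters\<close>

text \<open>
  A multiset records the numbers of occurrences of all words of length 2 at once, so that agreement
  of these numbers becomes a single equation, from which every count that depends on adjacent letters follows.
\<close>

definition adjacent_pairs :: "'a list \<Rightarrow> ('a \<times> 'a) multiset" where
  "adjacent_pairs u = mset (zip u (tl u))"

lemma adjacent_pairs_Nil [simp]: "adjacent_pairs [] = {#}"
  and adjacent_pairs_single [simp]: "adjacent_pairs [x] = {#}"
  and adjacent_pairs_Cons_Cons [simp]:
    "adjacent_pairs (x # y # u) = add_mset (x, y) (adjacent_pairs (y # u))"
  by (simp_all add: adjacent_pairs_def)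

lemma adjacent_pairs_Cons:
  "u \<noteq> [] \<Longrightarrow> adjacent_pairs (x # u) = add_mset (x, hd u) (adjacent_pairs u)"
  by (cases u) simp_all

lemma size_adjacent_pairs: "size (adjacent_pairs u) = length u - 1"
  by (simp add: adjacent_pairs_def)

lemma set_adjacent_pairs: "set_mset (adjacent_pairs u) \<subseteq> set u \<times> set u"
  unfolding adjacent_pairs_def
  by (cases u) (auto dest: set_zip_leftD set_zip_rightD)

lemma occurrences_pair: "occurrences [x, y] u = count (adjacent_pairs u) (x, y)"
proof -
  let ?F = "\<lambda>u. {(u1, u2). u = u1 @ [x, y] @ u2}"
  have "finite (?F u) \<and> card (?F u) = count (adjacent_pairs u) (x, y)"
  proof (induction u rule: induct_list012)
    case 1
    then show ?case by simp
  next
    case (2 a)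
    have "?F [a] = {}" by (auto simp: Cons_eq_append_conv)
    then show ?case by simp
  next
    case (3 a b u)
    let ?shift = "\<lambda>(u1, u2). (a # u1, u2)"
    have F: "?F (a # b # u) =
        (if (a, b) = (x, y) then {([], u)} else {}) \<union> ?shift ` ?F (b # u)"
      by (force simp: Cons_eq_append_conv)
    have inj: "inj_on ?shift (?F (b # u))"
      by (auto simp: inj_on_def)
    define G where "G = ?shift ` ?F (b # u)"
    have "finite G" and "card G = count (adjacent_pairs (b # u)) (x, y)"
      using 3(2) card_image[OF inj] by (auto simp: G_def)
    moreover have "([], u) \<notin> G" by (auto simp: G_def)
    ultimately have "finite (?F (a # b # u))"
      and "card (?F (a # b # u)) = of_bool ((a, b) = (x, y)) + count (adjacent_pairs (b # u)) (x, y)"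
      unfolding F G_def[symmetric] by (simp_all del: Pair_inject)
    then show ?case by auto
  qed
  then show ?thesis by (simp add: occurrences_def)
qed

lemma adjacent_pairs_eq_iff:
  assumes "u \<in> lists X" "u' \<in> lists X"
  shows "adjacent_pairs u = adjacent_pairs u' \<longleftrightarrow>
    (\<forall>v \<in> lists X. length v = 2 \<longrightarrow> occurrences v u = occurrences v u')"
proof
  assume "adjacent_pairs u = adjacent_pairs u'"
  then show "\<forall>v \<in> lists X. length v = 2 \<longrightarrow> occurrences v u = occurrences v u'"
    by (auto simp: numeral_2_eq_2 length_Suc_conv occurrences_pair)
next
  assume *: "\<forall>v \<in> lists X. length v = 2 \<longrightarrow> occurrences v u = occurrences v u'"
  show "adjacent_pairs u = adjacent_pairs u'"
  proof (rule multiset_eqI, clarify)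
    fix x y
    show "count (adjacent_pairs u) (x, y) = count (adjacent_pairs u') (x, y)"
    proof (cases "x \<in> X \<and> y \<in> X")
      case True
      then show ?thesis using *[rule_format, of "[x, y]"] by (simp add: occurrences_pair)
    next
      case False
      then have "(x, y) \<notin># adjacent_pairs u" "(x, y) \<notin># adjacent_pairs u'"
        using assms set_adjacent_pairs[of u] set_adjacent_pairs[of u'] by auto
      then show ?thesis by (simp add: not_in_iff)
    qed
  qed
qed

text \<open>
  Inclusion-exclusion over the \<open>length u - 1\<close> adjacent pairs: the first component is \<open>x\<close> at every
  occurrence of \<open>x\<close> except a final one, and the second component is \<open>y\<close> at every occurrence of \<open>y\<close>
  except an initial one. The equation is arranged so that no subtraction is needed.
\<close>

lemma count_adjacent_pairs:
  assumes "u \<noteq> []"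
  shows "size {#(a, b) \<in># adjacent_pairs u. (a = x) = (b = y)#} + count (mset u) x + count (mset u) y + 1
    = 2 * count (adjacent_pairs u) (x, y) + length u + of_bool (last u = x) + of_bool (hd u = y)"
  using assms by (induction u rule: induct_list012) auto

section \<open>Diagrams and their products\<close>

text \<open>
  The pair \<open>(n, None)\<close> stands for \<open>c^n\<close> and \<open>(n, Some (i, j))\<close> for \<open>c^n h(i,j)\<close>, with the index 1
  coded as \<open>True\<close> and the index 2 as \<open>False\<close>.
\<close>

type_synonym diagram = "nat \<times> (bool \<times> bool) option"

fun diagram_mult :: "diagram \<Rightarrow> diagram \<Rightarrow> diagram" where
  "diagram_mult (m, None) (n, d) = (m + n, d)"
| "diagram_mult (m, Some (i, j)) (n, None) = (m + n, Some (i, j))"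
| "diagram_mult (m, Some (i, j)) (n, Some (k, l)) = (m + n + of_bool (j = k), Some (i, l))"

lemma diagram_mult_assoc:
  "diagram_mult (diagram_mult a b) d = diagram_mult a (diagram_mult b d)"
proof -
  obtain m p n q k t where "a = (m, p)" "b = (n, q)" "d = (k, t)" by (metis surj_pair)
  then show ?thesis by (cases p; cases q; cases t) auto
qed

lemma diagram_mult_unit [simp]: "diagram_mult (0, None) a = a"
  by (cases a) simp

definition word_value :: "('a \<Rightarrow> diagram) \<Rightarrow> 'a list \<Rightarrow> diagram" where
  "word_value s w = foldr (\<lambda>x. diagram_mult (s x)) w (0, None)"

lemma word_value_Nil [simp]: "word_value s [] = (0, None)"
  and word_value_Cons [simp]: "word_value s (x # w) = diagram_mult (s x) (word_value s w)"
  by (simp_all add: word_value_def)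

lemma word_value_append:
  "word_value s (v @ w) = diagram_mult (word_value s v) (word_value s w)"
  by (induction v) (simp_all add: diagram_mult_assoc)

lemma word_value_concat:
  "word_value s (concat (map g w)) = word_value (\<lambda>x. word_value s (g x)) w"
  by (induction w) (simp_all add: word_value_append)

definition assignment :: "('a \<Rightarrow> nat) \<Rightarrow> 'a set \<Rightarrow> ('a \<Rightarrow> bool) \<Rightarrow> ('a \<Rightarrow> bool) \<Rightarrow> 'a \<Rightarrow> diagram" where
  "assignment n Y l r x = (n x, if x \<in> Y then None else Some (l x, r x))"

lemma assignment_cases:
  obtains n Y l r where "s = assignment n Y l r"
proof
  show "s = assignment (\<lambda>x. fst (s x)) {x. snd (s x) = None}
      (\<lambda>x. fst (the (snd (s x)))) (\<lambda>x. snd (the (snd (s x))))"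
    by (auto simp: assignment_def fun_eq_iff prod_eq_iff)
qed

text \<open>
  Central factors only add to the exponent, and in the product of the others each pair of neighbours
  contributes one factor \<open>c\<close> if its inner indices agree; of all the indices only the two outermost survive.
\<close>

lemma word_value_assignment:
  "word_value (assignment n Y l r) w =
    (let u = delete_letters Y w in
      (sum_mset (image_mset n (mset w)) + size {#(x, y) \<in># adjacent_pairs u. r x = l y#},
       if u = [] then None else Some (l (hd u), r (last u))))"
proof (induction w)
  case Nil
  then show ?case by (simp add: delete_letters_def)
next
  case (Cons a w)
  let ?u = "delete_letters Y w"
  show ?case
  proof (cases "a \<in> Y")
    case True
    then have "delete_letters Y (a # w) = ?u" and "assignment n Y l r a = (n a, None)"
      by (simp_all add: delete_letters_def assignment_def)
    then show ?thesis by (simp add: Cons.IH Let_def)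
  next
    case False
    then have "delete_letters Y (a # w) = a # ?u"
      and "assignment n Y l r a = (n a, Some (l a, r a))"
      by (simp_all add: delete_letters_def assignment_def)
    then show ?thesis by (simp add: Cons.IH Let_def adjacent_pairs_Cons)
  qed
qed

section \<open>Normal forms in the Kauffman monoid\<close>

abbreviation kauffman_cong :: "kauffman_gen list \<Rightarrow> kauffman_gen list \<Rightarrow> bool" (infix "\<approx>" 50) where
  "u \<approx> v \<equiv> (u, v) \<in> gen_congruence kauffman3_rels"

fun gen_diagram :: "kauffman_gen \<Rightarrow> diagram" where
  "gen_diagram kauffman_gen.c = (1, None)"
| "gen_diagram kauffman_gen.h1 = (0, Some (True, True))"
| "gen_diagram kauffman_gen.h2 = (0, Some (False, False))"

definition hook :: "bool \<Rightarrow> kauffman_gen" where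
  "hook i = (if i then kauffman_gen.h1 else kauffman_gen.h2)"

fun planar_word :: "(bool \<times> bool) option \<Rightarrow> kauffman_gen list" where
  "planar_word None = []"
| "planar_word (Some (i, j)) = (if i = j then [hook i] else [hook i, hook j])"

definition normal_form :: "diagram \<Rightarrow> kauffman_gen list" where
  "normal_form a = replicate (fst a) kauffman_gen.c @ planar_word (snd a)"

lemma word_value_normal_form: "word_value gen_diagram (normal_form a) = a"
proof -
  have central: "word_value gen_diagram (replicate n kauffman_gen.c @ v) =
      diagram_mult (n, None) (word_value gen_diagram v)" for n v
    by (induction n) (simp_all add: diagram_mult_assoc[symmetric])
  have "word_value gen_diagram (planar_word d) = (0, d)" for d
    by (cases d rule: planar_word.cases) (auto simp: hook_def)
  then show ?thesis by (simp add: normal_form_def central)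
qed

lemma cong_word_value:
  assumes "u \<approx> v"
  shows "word_value gen_diagram u = word_value gen_diagram v"
  using assms
proof (induction rule: gen_congruence.induct)
  case (rel u v)
  then show ?case by (auto simp: kauffman3_rels_def)
qed (simp_all add: word_value_append)

lemma cong_context: "u \<approx> v \<Longrightarrow> p @ u @ q \<approx> p @ v @ q"
  by (intro gen_congruence.append gen_congruence.refl)

lemma cong_hook_replicate_c:
  "hook i # replicate n kauffman_gen.c \<approx> replicate n kauffman_gen.c @ [hook i]"
proof (induction n)
  case 0
  then show ?case by (simp add: gen_congruence.refl)
next
  case (Suc n)
  have "[kauffman_gen.c, hook i] \<approx> [hook i, kauffman_gen.c]"
    by (rule gen_congruence.rel) (simp add: kauffman3_rels_def hook_def)
  from cong_context[OF gen_congruence.sym[OF this], of "[]" "replicate n kauffman_gen.c"]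
  have "hook i # replicate (Suc n) kauffman_gen.c \<approx>
      kauffman_gen.c # hook i # replicate n kauffman_gen.c" by simp
  moreover have "kauffman_gen.c # hook i # replicate n kauffman_gen.c \<approx>
      replicate (Suc n) kauffman_gen.c @ [hook i]"
    using cong_context[OF Suc, of "[kauffman_gen.c]" "[]"] by simp
  ultimately show ?case by (rule gen_congruence.trans)
qed

lemma cong_hook_planar_word:
  "hook i # planar_word d \<approx> normal_form (diagram_mult (0, Some (i, i)) (0, d))"
proof (cases d rule: planar_word.cases)
  case 1
  then show ?thesis by (simp add: normal_form_def gen_congruence.refl)
next
  case (2 k l)
  have square: "[hook i, hook i] \<approx> [kauffman_gen.c, hook i]"
    by (rule gen_congruence.rel) (simp add: kauffman3_rels_def hook_def)
  have zigzag: "[hook i, hook j, hook i] \<approx> [hook i]" if "i \<noteq> j" for j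
    using that by (intro gen_congruence.rel) (simp add: kauffman3_rels_def hook_def)
  show ?thesis
  proof (cases "i = k")
    case True
    then show ?thesis
      using 2 cong_context[OF square, of "[]" "if k = l then [] else [hook l]"]
      by (auto simp: normal_form_def)
  next
    case False
    then show ?thesis
      using 2 zigzag[of k] by (cases "k = l") (auto simp: normal_form_def gen_congruence.refl)
  qed
qed

text \<open>
  Generators are prepended one at a time: a hook first moves past the powers of \<open>c\<close>, then it is absorbed by
  the at most two hooks behind them.
\<close>

lemma cong_normal_form: "w \<approx> normal_form (word_value gen_diagram w)"
proof (induction w)
  case Nil
  then show ?case by (simp add: normal_form_def gen_congruence.refl)
next
  case (Cons g w)
  obtain n d where v: "word_value gen_diagram w = (n, d)" by fastforce
  have "g # w \<approx> g # normal_form (n, d)"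
    using cong_context[OF Cons, of "[g]" "[]"] by (simp add: v)
  moreover have "g # normal_form (n, d) \<approx> normal_form (diagram_mult (gen_diagram g) (n, d))"
  proof (cases "g = kauffman_gen.c")
    case True
    then show ?thesis by (simp add: normal_form_def gen_congruence.refl)
  next
    case False
    then obtain i where g: "g = hook i" and gd: "gen_diagram g = (0, Some (i, i))"
      by (cases g) (auto simp: hook_def)
    have "hook i # normal_form (n, d) \<approx> replicate n kauffman_gen.c @ hook i # planar_word d"
      using cong_context[OF cong_hook_replicate_c, of "[]" i n "planar_word d"]
      by (simp add: normal_form_def)
    moreover have "replicate n kauffman_gen.c @ hook i # planar_word d \<approx>
        replicate n kauffman_gen.c @ normal_form (diagram_mult (0, Some (i, i)) (0, d))"
      by (intro gen_congruence.append gen_congruence.refl cong_hook_planar_word)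
    moreover have "replicate n kauffman_gen.c @ normal_form (diagram_mult (0, Some (i, i)) (0, d)) =
        normal_form (diagram_mult (0, Some (i, i)) (n, d))"
      by (cases d rule: planar_word.cases) (auto simp: normal_form_def replicate_add)
    ultimately show ?thesis by (metis g gd gen_congruence.trans)
  qed
  ultimately show ?case by (metis gen_congruence.trans v word_value_Cons)
qed

text \<open>
  The relations are valid for diagrams, and each congruence class contains the normal form of the
  diagram that it determines; hence the presented monoid is the monoid of diagrams.
\<close>

lemma gen_congruence_iff_word_value_eq:
  "u \<approx> v \<longleftrightarrow> word_value gen_diagram u = word_value gen_diagram v"
  by (metis cong_word_value cong_normal_form gen_congruence.sym gen_congruence.trans)

section \<open>Identities as equations between values\<close>

abbreviation kauffman_class :: "kauffman_gen list \<Rightarrow> kauffman_gen list set" where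
  "kauffman_class u \<equiv> gen_congruence kauffman3_rels `` {u}"

lemma kauffman_class_eq_iff:
  "kauffman_class u = kauffman_class v \<longleftrightarrow>
    word_value gen_diagram u = word_value gen_diagram v"
  using eq_equiv_class_iff[OF equiv_gen_congruence, of u v kauffman3_rels]
  by (simp add: gen_congruence_iff_word_value_eq)

lemma substitution_monoid_hom:
  "(\<lambda>w. kauffman_class (concat (map g w))) \<in> monoid_hom (free_monoid X) kauffman3"
  by (auto simp: monoid_hom_def hom_def free_monoid_def kauffman3_def mult_presented_monoid)
    (auto simp: presented_monoid_def quotient_def)

lemma monoid_hom_is_substitution:
  assumes "\<phi> \<in> monoid_hom (free_monoid X) kauffman3"
  shows "\<exists>g. \<forall>w \<in> lists X. \<phi> w = kauffman_class (concat (map g w))"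
proof -
  have one: "\<phi> [] = kauffman_class []"
    and mult: "\<And>u v. u \<in> lists X \<Longrightarrow> v \<in> lists X \<Longrightarrow> \<phi> (u @ v) = \<phi> u \<otimes>\<^bsub>kauffman3\<^esub> \<phi> v"
    and carrier: "\<And>u. u \<in> lists X \<Longrightarrow> \<phi> u \<in> carrier kauffman3"
    using assms
    by (auto simp: monoid_hom_def hom_def free_monoid_def kauffman3_def presented_monoid_def)
  have "\<exists>v. \<phi> [x] = kauffman_class v" if "x \<in> X" for x
    using carrier[of "[x]"] that
    by (auto simp: kauffman3_def presented_monoid_def quotient_def)
  then obtain g where g: "\<And>x. x \<in> X \<Longrightarrow> \<phi> [x] = kauffman_class (g x)" by metis
  have "\<phi> w = kauffman_class (concat (map g w))" if "w \<in> lists X" for w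
    using that
  proof (induction w)
    case Nil
    then show ?case by (simp add: one)
  next
    case (Cons x w)
    then have "\<phi> (x # w) = kauffman_class (g x) \<otimes>\<^bsub>kauffman3\<^esub> kauffman_class (concat (map g w))"
      using mult[of "[x]" w] g by simp
    then show ?case by (simp add: kauffman3_def mult_presented_monoid)
  qed
  then show ?thesis by blast
qed

lemma identity_holds_iff_word_value_eq:
  assumes "w \<in> lists X" "w' \<in> lists X"
  shows "identity_holds X kauffman3 w w' \<longleftrightarrow> (\<forall>s. word_value s w = word_value s w')"
proof
  assume holds: "identity_holds X kauffman3 w w'"
  show "\<forall>s. word_value s w = word_value s w'"
  proof
    fix s
    have "kauffman_class (concat (map (\<lambda>x. normal_form (s x)) w)) =
        kauffman_class (concat (map (\<lambda>x. normal_form (s x)) w'))"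
      by (rule bspec[OF holds[unfolded identity_holds_def] substitution_monoid_hom])
    then show "word_value s w = word_value s w'"
      by (simp add: kauffman_class_eq_iff word_value_concat word_value_normal_form)
  qed
next
  assume eq: "\<forall>s. word_value s w = word_value s w'"
  show "identity_holds X kauffman3 w w'"
    unfolding identity_holds_def
  proof
    fix \<phi> assume "\<phi> \<in> monoid_hom (free_monoid X) kauffman3"
    then obtain g where "\<forall>w \<in> lists X. \<phi> w = kauffman_class (concat (map g w))"
      using monoid_hom_is_substitution by metis
    with assms eq show "\<phi> w = \<phi> w'"
      by (simp add: kauffman_class_eq_iff word_value_concat)
  qed
qed

section \<open>Reading off the combinatorial data\<close>

lemma mset_eq_of_word_value_eq:
  assumes "\<forall>s. word_value s w = word_value s w'"
  shows "mset w = mset w'"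
proof (rule multiset_eqI)
  fix x
  \<comment> \<open>Send \<open>x\<close> to \<open>c\<close> and all other letters to the unit.\<close>
  have multiplicity: "word_value (assignment (\<lambda>z. of_bool (z = x)) UNIV l r) v = (count (mset v) x, None)"
    for v :: "'a list" and l r
    by (induction v) (auto simp: assignment_def)
  show "count (mset w) x = count (mset w') x"
    using assms[rule_format, of "assignment (\<lambda>z. of_bool (z = x)) UNIV (\<lambda>_. True) (\<lambda>_. True)"]
    by (simp add: multiplicity)
qed

lemma deleted_data_eq_of_word_value_eq:
  fixes w w' :: "'a list"
  assumes eq: "\<forall>s. word_value s w = word_value s w'"
    and ne: "delete_letters Y w \<noteq> []"
  shows "hd (delete_letters Y w) = hd (delete_letters Y w')"
    and "last (delete_letters Y w) = last (delete_letters Y w')"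
    and "adjacent_pairs (delete_letters Y w) = adjacent_pairs (delete_letters Y w')"
proof -
  let ?u = "delete_letters Y w" and ?u' = "delete_letters Y w'"
  have mset: "mset ?u = mset ?u'"
    using mset_eq_of_word_value_eq[OF eq] by (simp add: delete_letters_def)
  then have ne': "?u' \<noteq> []" using ne by auto
  have loops: "size {#(x, y) \<in># adjacent_pairs ?u. r x = l y#} =
      size {#(x, y) \<in># adjacent_pairs ?u'. r x = l y#}"
    and left: "l (hd ?u) = l (hd ?u')" and right: "r (last ?u) = r (last ?u')" for l r :: "'a \<Rightarrow> bool"
    using eq[rule_format, of "assignment (\<lambda>_. 0) Y l r"] ne ne'
    by (simp_all add: word_value_assignment Let_def)
  \<comment> \<open>Let \<open>l\<close> and \<open>r\<close> be the indicator functions of the letters to be detected.\<close>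
  show hd: "hd ?u = hd ?u'" using left[of "\<lambda>z. z = hd ?u"] by simp
  show last: "last ?u = last ?u'" using right[of "\<lambda>z. z = last ?u"] by simp
  show "adjacent_pairs ?u = adjacent_pairs ?u'"
  proof (rule multiset_eqI, clarify)
    fix x y
    show "count (adjacent_pairs ?u) (x, y) = count (adjacent_pairs ?u') (x, y)"
      using count_adjacent_pairs[OF ne, of x y] count_adjacent_pairs[OF ne', of x y]
        loops[of "\<lambda>z. z = x" "\<lambda>z. z = y"] mset mset_eq_length[OF mset] hd last
      by simp
  qed
qed

lemma set_delete_letters: "set (delete_letters Y w) = set w - Y"
  by (auto simp: delete_letters_def)

text \<open>
  After deletion of all letters but \<open>x\<close>, a nonempty power of \<open>x\<close> remains; its length is one more than
  the number of its adjacent pairs.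
\<close>

lemma mset_eq_of_adjacent_pairs_eq:
  assumes set: "set w = set w'"
    and pairs: "\<And>Y. Y \<subset> set w \<Longrightarrow>
      adjacent_pairs (delete_letters Y w) = adjacent_pairs (delete_letters Y w')"
  shows "mset w = mset w'"
proof (rule multiset_eqI)
  fix x
  show "count (mset w) x = count (mset w') x"
  proof (cases "x \<in> set w")
    case True
    let ?Y = "set w - {x}"
    have length: "length (delete_letters ?Y v) = count (mset v) x" if "set v = set w" for v
    proof -
      have "delete_letters ?Y v = filter (\<lambda>z. x = z) v"
        unfolding delete_letters_def using that by (intro filter_cong) auto
      then show ?thesis
        by (metis count_mset count_list_eq_length_filter)
    qed
    have "count (mset w) x - 1 = count (mset w') x - 1"
      unfolding length[OF HOL.refl, symmetric] length[OF set[symmetric], symmetric]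
      using pairs[of ?Y] True by (metis Diff_subset DiffD2 insertI1 psubsetI size_adjacent_pairs)
    moreover have "count (mset w) x > 0" and "count (mset w') x > 0"
      using True set by (simp_all only: count_greater_zero_iff set_mset_mset)
    ultimately show ?thesis by linarith
  next
    case False
    then show ?thesis using set by (metis count_mset_0_iff)
  qed
qed

lemma word_value_eq_of_deleted_data_eq:
  assumes set: "set w = set w'"
    and data: "\<And>Y. Y \<subset> set w \<Longrightarrow>
      hd (delete_letters Y w) = hd (delete_letters Y w') \<and>
      last (delete_letters Y w) = last (delete_letters Y w') \<and>
      adjacent_pairs (delete_letters Y w) = adjacent_pairs (delete_letters Y w')"
  shows "word_value s w = word_value s w'"
proof -
  obtain n Y l r where s: "s = assignment n Y l r" by (rule assignment_cases)
  have mset: "mset w = mset w'"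
    using set data by (intro mset_eq_of_adjacent_pairs_eq) auto
  have empty_iff: "delete_letters Y w = [] \<longleftrightarrow> delete_letters Y w' = []"
    using set by (metis set_delete_letters set_empty)
  show ?thesis
  proof (cases "set w \<subseteq> Y")
    case True
    then have "delete_letters Y w = []" by (metis Diff_eq_empty_iff set_delete_letters set_empty)
    with empty_iff show ?thesis by (simp add: s word_value_assignment Let_def mset)
  next
    case False
    then have "Y \<inter> set w \<subset> set w" by auto
    moreover have "delete_letters (Y \<inter> set w) v = delete_letters Y v" if "set v = set w" for v
      unfolding delete_letters_def using that by (intro filter_cong) auto
    ultimately have "hd (delete_letters Y w) = hd (delete_letters Y w') \<and>
        last (delete_letters Y w) = last (delete_letters Y w') \<and>
        adjacent_pairs (delete_letters Y w) = adjacent_pairs (delete_letters Y w')"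
      using data[of "Y \<inter> set w"] set by simp
    with empty_iff show ?thesis by (simp add: s word_value_assignment Let_def mset)
  qed
qed

theorem theorem3:
  fixes X :: "'a set" and w w' :: "'a list"
  assumes "countable X" and "infinite X"
    and "w \<in> lists X" and "w' \<in> lists X"
  shows "identity_holds X kauffman3 w w' \<longleftrightarrow>
    set w = set w' \<and>
    (\<forall>Y. Y \<subset> set w \<longrightarrow>
      (let u = delete_letters Y w; u' = delete_letters Y w' in
        hd u = hd u' \<and>
        last u = last u' \<and>
        (\<forall>v \<in> lists X. length v = 2 \<longrightarrow> occurrences v u = occurrences v u')))"
proof -
  have pairs_iff: "(\<forall>v \<in> lists X. length v = 2 \<longrightarrow>
        occurrences v (delete_letters Y w) = occurrences v (delete_letters Y w')) \<longleftrightarrow>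
      adjacent_pairs (delete_letters Y w) = adjacent_pairs (delete_letters Y w')" for Y
    using assms(3,4) by (intro adjacent_pairs_eq_iff[symmetric]) (auto simp: delete_letters_def)
  have ne: "delete_letters Y w \<noteq> []" if "Y \<subset> set w" for Y
    using that set_delete_letters[of Y w] by auto
  show ?thesis
    unfolding identity_holds_iff_word_value_eq[OF assms(3,4)] Let_def pairs_iff
  proof (intro iffI conjI allI impI)
    assume eq: "\<forall>s. word_value s w = word_value s w'"
    show "set w = set w'" using mset_eq_of_word_value_eq[OF eq] by (rule mset_eq_setD)
    fix Y assume "Y \<subset> set w"
    note deleted_data_eq_of_word_value_eq[OF eq ne[OF this]]
    then show "hd (delete_letters Y w) = hd (delete_letters Y w')"
      and "last (delete_letters Y w) = last (delete_letters Y w')"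
      and "adjacent_pairs (delete_letters Y w) = adjacent_pairs (delete_letters Y w')"
      by simp_all
  next
    fix s
    assume "set w = set w' \<and> (\<forall>Y. Y \<subset> set w \<longrightarrow>
      hd (delete_letters Y w) = hd (delete_letters Y w') \<and>
      last (delete_letters Y w) = last (delete_letters Y w') \<and>
      adjacent_pairs (delete_letters Y w) = adjacent_pairs (delete_letters Y w'))"
    then show "word_value s w = word_value s w'"
      using word_value_eq_of_deleted_data_eq by blast
  qed
qed

end
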